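(* The map $\eta_0:\mathbb{R}_{>0}^{2n}\to[0,1]$, $(w_1,l_1,\dots,w_n,l_n)\mapsto\eta_0(w_1,l_1,\dots,w_n,l_n)$, is continuous.
   Context: A vector $A=(w_1,l_1,\dots,w_n,l_n)\in\mathbb{R}_{>0}^{2n}$ is identified with a set of rectangles $A_1,\dots,A_n$, $A_i$ of size $w_i\times l_i$ as an ordered pair (it is not assumed that $w_i\le l_i$). A positioning of $A$ is a placement of these rectangles in the plane with pairwise disjoint interiors, sides parallel to the coordinate axes, and the side of $A_i$ of length $w_i$ parallel to the $x$-axis. If $A_i$ has lower left corner $(x_i^-,y_i^-)$ and upper right corner $(x_i^+,y_i^+)$, set $p(A_M)=\max_{i,j}(x_i^+-x_j^-)$, $q(A_M)=\max_{i,j}(y_i^+-y_j^-)$, $T(A_M)=p(A_M)q(A_M)$, $S(A)=\sum_{i=1}^n w_il_i$, and packing efficiency $\eta(A_M)=S(A)/T(A_M)$. The best packing efficiency is $\eta_0(A)=\sup\eta(A_M)$, the supremum over all positionings $A_M$ of $A$. *)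

theory Defs
  imports "HOL-Analysis.Analysis"
begin

(* A vector (w_1, l_1, ..., w_n, l_n) is an element A of (real \<times> real)^'n with n = CARD('n) and
   A $ i = (w_i, l_i). Its norm and topology are those of Euclidean space of dimension 2n.
   Points of the plane are pairs; the x-axis is the first component. *)

definition rect_vectors :: "((real \<times> real) ^ 'n) set" where
  "rect_vectors = {A. \<forall>i. 0 < fst (A $ i) \<and> 0 < snd (A $ i)}"

(* A placement is given by the lower left corners c $ i of the rectangles;
   the upper right corner is then c $ i + A $ i. *)

definition placed_rect :: "(real \<times> real) ^ 'n \<Rightarrow> (real \<times> real) ^ 'n \<Rightarrow> 'n \<Rightarrow> (real \<times> real) set" where
  "placed_rect A c i = cbox (c $ i) (c $ i + A $ i)"

definition positioning :: "(real \<times> real) ^ 'n \<Rightarrow> (real \<times> real) ^ 'n \<Rightarrow> bool" where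
  "positioning A c \<longleftrightarrow>
     (\<forall>i j. i \<noteq> j \<longrightarrow> interior (placed_rect A c i) \<inter> interior (placed_rect A c j) = {})"

definition p_extent :: "(real \<times> real) ^ 'n \<Rightarrow> (real \<times> real) ^ 'n \<Rightarrow> real" where
  "p_extent A c = Max (range (\<lambda>(i, j). fst (c $ i + A $ i) - fst (c $ j)))"

definition q_extent :: "(real \<times> real) ^ 'n \<Rightarrow> (real \<times> real) ^ 'n \<Rightarrow> real" where
  "q_extent A c = Max (range (\<lambda>(i, j). snd (c $ i + A $ i) - snd (c $ j)))"

definition total_area :: "(real \<times> real) ^ 'n \<Rightarrow> (real \<times> real) ^ 'n \<Rightarrow> real" where
  "total_area A c = p_extent A c * q_extent A c"

definition rect_area :: "(real \<times> real) ^ 'n \<Rightarrow> real" where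
  "rect_area A = (\<Sum>i\<in>UNIV. fst (A $ i) * snd (A $ i))"

definition packing_efficiency :: "(real \<times> real) ^ 'n \<Rightarrow> (real \<times> real) ^ 'n \<Rightarrow> real" where
  "packing_efficiency A c = rect_area A / total_area A c"

(* For A in rect_vectors, positionings exist and all efficiencies are at most 1,
   so this Sup of reals is a genuine supremum. *)

definition best_efficiency :: "(real \<times> real) ^ 'n \<Rightarrow> real" where
  "best_efficiency A = (SUP c \<in> {c. positioning A c}. packing_efficiency A c)"

end

theory Submission
  imports Defs
begin

text \<open>If every side of \<open>B\<close> is at most \<open>r\<close> times the corresponding side of \<open>A\<close>, then dilating a
  positioning of \<open>A\<close> by \<open>r\<close> leaves room for the rectangles of \<open>B\<close>, at the price of a factor \<open>r\<^sup>2\<close>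
  in the total area. Hence the best efficiency divided by the area sum drops by a factor of at most
  \<open>r\<^sup>2\<close> from \<open>A\<close> to \<open>B\<close>. Applying this in both directions, with \<open>r\<close> tending to \<open>1\<close> as \<open>B\<close> tends
  to \<open>A\<close>, squeezes the best efficiency of \<open>B\<close>.\<close>

section \<open>Bounds on extents and positivity of areas\<close>

lemma p_extent_ge: "fst (c $ i + A $ i) - fst (c $ j) \<le> p_extent A c"
  unfolding p_extent_def by (rule Max_ge) (auto intro!: image_eqI[where x = "(i, j)"])

lemma q_extent_ge: "snd (c $ i + A $ i) - snd (c $ j) \<le> q_extent A c"
  unfolding q_extent_def by (rule Max_ge) (auto intro!: image_eqI[where x = "(i, j)"])

lemma p_extent_leI:
  assumes "\<And>i j. fst (c $ i + A $ i) - fst (c $ j) \<le> b"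
  shows "p_extent A c \<le> b"
  unfolding p_extent_def using assms by (subst Max_le_iff) auto

lemma q_extent_leI:
  assumes "\<And>i j. snd (c $ i + A $ i) - snd (c $ j) \<le> b"
  shows "q_extent A c \<le> b"
  unfolding q_extent_def using assms by (subst Max_le_iff) auto

lemma p_extent_pos: "A \<in> rect_vectors \<Longrightarrow> 0 < p_extent A c"
  \<comment> \<open>With equal indices the corner cancels and a side of \<open>A\<close> remains;
    \<open>undefined\<close> is just some element of the index type.\<close>
  using p_extent_ge[of c undefined A undefined] by (auto simp: rect_vectors_def intro: less_le_trans)

lemma q_extent_pos: "A \<in> rect_vectors \<Longrightarrow> 0 < q_extent A c"
  using q_extent_ge[of c undefined A undefined] by (auto simp: rect_vectors_def intro: less_le_trans)

lemma total_area_pos: "A \<in> rect_vectors \<Longrightarrow> 0 < total_area A c"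
  by (simp add: total_area_def p_extent_pos q_extent_pos)

lemma rect_area_pos: "A \<in> rect_vectors \<Longrightarrow> 0 < rect_area A"
  unfolding rect_area_def by (rule sum_pos) (auto simp: rect_vectors_def)

section \<open>Efficiencies lie in the unit interval, and positionings exist\<close>

lemma positioning_iff_box:
  "positioning A c \<longleftrightarrow>
     (\<forall>i j. i \<noteq> j \<longrightarrow> box (c $ i) (c $ i + A $ i) \<inter> box (c $ j) (c $ j + A $ j) = {})"
  by (simp add: positioning_def placed_rect_def)

lemma mem_box_real_pair:
  fixes a b x :: "real \<times> real"
  shows "x \<in> box a b \<longleftrightarrow> fst a < fst x \<and> fst x < fst b \<and> snd a < snd x \<and> snd x < snd b"
  by (auto simp: box_def Basis_prod_def inner_prod_def)

lemma measure_box_real_pair: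
  fixes a b :: "real \<times> real"
  assumes "fst a \<le> fst b" "snd a \<le> snd b"
  shows "measure lborel (box a b) = (fst b - fst a) * (snd b - snd a)"
proof -
  have "measure lborel (box a b) = measure lborel (cbox (fst a, snd a) (fst b, snd b))"
    using assms by (simp add: measure_lborel_box_eq measure_lborel_cbox_eq)
  also have "\<dots> = (fst b - fst a) * (snd b - snd a)"
    using assms by (simp only: content_Pair) simp
  finally show ?thesis .
qed

text \<open>The open rectangles are literally disjoint, so their areas add up to the measure of
  their union, which lies in the bounding box \<open>Q\<close> of area
  \<open>total_area A c\<close>.\<close>

lemma rect_area_le_total_area:
  fixes A c :: "(real \<times> real) ^ 'n::finite"
  assumes A: "A \<in> rect_vectors" and c: "positioning A c"
  shows "rect_area A \<le> total_area A c"
proof -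
  define R where "R i = box (c $ i) (c $ i + A $ i)" for i
  define m where "m = (Min (range (\<lambda>i. fst (c $ i))), Min (range (\<lambda>i. snd (c $ i))))"
  define Q where "Q = box m (m + (p_extent A c, q_extent A c))"
  have pos: "0 < fst (A $ i)" "0 < snd (A $ i)" for i
    using A by (auto simp: rect_vectors_def)
  \<comment> \<open>The two minima are attained, possibly by different rectangles. Taking such a
    \<open>j\<close> in the extent bounds keeps every upper right corner inside
    \<open>Q\<close>.\<close>
  have "\<exists>j. fst m = fst (c $ j)" "\<exists>j. snd m = snd (c $ j)"
    using Min_in[of "range (\<lambda>i. fst (c $ i))"] Min_in[of "range (\<lambda>i. snd (c $ i))"]
    unfolding m_def image_iff by simp_all
  then have up: "fst (c $ i + A $ i) \<le> fst m + p_extent A c"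
      "snd (c $ i + A $ i) \<le> snd m + q_extent A c" for i
    using p_extent_ge[of c i A] q_extent_ge[of c i A] by (auto simp: diff_le_eq add.commute)
  have low: "fst m \<le> fst (c $ i)" "snd m \<le> snd (c $ i)" for i
    by (auto simp: m_def)
  have sub: "(\<Union>i. R i) \<subseteq> Q"
  proof
    fix x assume "x \<in> (\<Union>i. R i)"
    then obtain i where "x \<in> R i" by blast
    then show "x \<in> Q"
      using up[of i] low[of i] by (auto simp: R_def Q_def mem_box_real_pair)
  qed
  have "rect_area A = (\<Sum>i\<in>UNIV. measure lborel (R i))"
    using pos by (simp add: rect_area_def R_def measure_box_real_pair less_imp_le)
  also have "\<dots> = measure lborel (\<Union>i. R i)"
  proof (rule measure_finite_Union[symmetric])
    show "disjoint_family_on R UNIV"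
      using c by (auto simp: positioning_iff_box R_def disjoint_family_on_def)
  qed (auto simp: R_def emeasure_lborel_box_eq)
  also have "\<dots> \<le> measure lborel Q"
  proof (rule measure_mono_fmeasurable[OF sub])
    show "Q \<in> fmeasurable lborel"
      by (simp add: Q_def)
  qed (auto simp: R_def)
  also have "\<dots> = total_area A c"
    using p_extent_pos[OF A, of c] q_extent_pos[OF A, of c]
    by (simp add: Q_def measure_box_real_pair total_area_def)
  finally show ?thesis .
qed

lemma packing_efficiency_nonneg: "A \<in> rect_vectors \<Longrightarrow> 0 \<le> packing_efficiency A c"
  using rect_area_pos[of A] total_area_pos[of A c] by (simp add: packing_efficiency_def)

lemma packing_efficiency_le_1:
  "A \<in> rect_vectors \<Longrightarrow> positioning A c \<Longrightarrow> packing_efficiency A c \<le> 1"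
  using rect_area_le_total_area[of A c] total_area_pos[of A c] by (simp add: packing_efficiency_def)

lemma bdd_above_packing_efficiency:
  "A \<in> rect_vectors \<Longrightarrow> bdd_above (packing_efficiency A ` {c. positioning A c})"
  by (auto intro!: bdd_aboveI2[where M = 1] packing_efficiency_le_1)

text \<open>The rectangles are set side by side along the x-axis, in slots of equal width. This
  makes the supremum in \<open>best_efficiency\<close> range over a nonempty set.\<close>

lemma positioning_exists:
  fixes A :: "(real \<times> real) ^ 'n::finite"
  assumes A: "A \<in> rect_vectors"
  shows "\<exists>c. positioning A c"
proof -
  obtain f :: "'n \<Rightarrow> nat" where f: "inj f"
    using finite_imp_inj_to_nat_seg[of "UNIV :: 'n set"] by auto
  \<comment> \<open>The sum serves as a slot width because it bounds every single width.\<close>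
  define M where "M = (\<Sum>i\<in>UNIV. fst (A $ i))"
  have pos: "0 < fst (A $ i)" for i
    using A by (auto simp: rect_vectors_def)
  have M: "fst (A $ i) \<le> M" for i
    unfolding M_def using pos by (intro member_le_sum) (auto simp: less_imp_le)
  have M0: "0 \<le> M"
    using pos[of undefined] M[of undefined] by simp
  define c where "c = (\<chi> i. (M * real (f i), 0::real))"
  have sep: "box (c $ i) (c $ i + A $ i) \<inter> box (c $ j) (c $ j + A $ j) = {}" if "f i < f j" for i j
  proof -
    have "M * (real (f i) + 1) \<le> M * real (f j)"
      using that M0 by (intro mult_left_mono) auto
    then have "M * real (f i) + fst (A $ i) \<le> M * real (f j)"
      using M[of i] by (simp add: algebra_simps)
    then show ?thesis
      by (auto simp: c_def mem_box_real_pair)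
  qed
  have "positioning A c"
    unfolding positioning_iff_box
  proof (intro allI impI)
    fix i j :: 'n assume "i \<noteq> j"
    then have "f i < f j \<or> f j < f i"
      using f by (metis injD linorder_neqE_nat)
    then show "box (c $ i) (c $ i + A $ i) \<inter> box (c $ j) (c $ j + A $ j) = {}"
      using sep[of i j] sep[of j i] by blast
  qed
  then show ?thesis ..
qed

lemma best_efficiency_in_01:
  assumes A: "A \<in> rect_vectors"
  shows "best_efficiency A \<in> {0..1}"
proof -
  obtain c where c: "positioning A c"
    using positioning_exists[OF A] by blast
  have "packing_efficiency A c \<le> best_efficiency A"
    unfolding best_efficiency_def using c bdd_above_packing_efficiency[OF A]
    by (intro cSUP_upper) auto
  moreover have "best_efficiency A \<le> 1"
    unfolding best_efficiency_def using c packing_efficiency_le_1[OF A]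
    by (intro cSUP_least) auto
  ultimately show ?thesis
    using packing_efficiency_nonneg[OF A, of c] by simp
qed

section \<open>Comparing two vectors by dilation\<close>

lemma positioning_scaleR:
  fixes A B c :: "(real \<times> real) ^ 'n::finite"
  assumes r: "0 < r" and c: "positioning A c"
    and le: "\<And>i. fst (B $ i) \<le> r * fst (A $ i)" "\<And>i. snd (B $ i) \<le> r * snd (A $ i)"
  shows "positioning B (r *\<^sub>R c)"
  unfolding positioning_iff_box
proof (intro allI impI)
  fix i j :: 'n assume ij: "i \<noteq> j"
  \<comment> \<open>Shrinking by \<open>r\<close> sends the open rectangle of \<open>B\<close> with
    index \<open>k\<close> into that of \<open>A\<close>, so an overlap for \<open>B\<close> would
    yield one for \<open>A\<close>.\<close>
  have mem: "(1 / r) *\<^sub>R x \<in> box (c $ k) (c $ k + A $ k)"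
    if "x \<in> box ((r *\<^sub>R c) $ k) ((r *\<^sub>R c) $ k + B $ k)" for x k
    using that le[of k] r by (auto simp: mem_box_real_pair field_simps)
  show "box ((r *\<^sub>R c) $ i) ((r *\<^sub>R c) $ i + B $ i) \<inter> box ((r *\<^sub>R c) $ j) ((r *\<^sub>R c) $ j + B $ j) = {}"
    using mem[of _ i] mem[of _ j] c ij unfolding positioning_iff_box by blast
qed

lemma total_area_scaleR_le:
  fixes A B c :: "(real \<times> real) ^ 'n::finite"
  assumes r: "0 < r" and A: "A \<in> rect_vectors" and B: "B \<in> rect_vectors"
    and le: "\<And>i. fst (B $ i) \<le> r * fst (A $ i)" "\<And>i. snd (B $ i) \<le> r * snd (A $ i)"
  shows "total_area B (r *\<^sub>R c) \<le> r\<^sup>2 * total_area A c"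
proof -
  have "p_extent B (r *\<^sub>R c) \<le> r * p_extent A c"
  proof (rule p_extent_leI)
    fix i j :: 'n
    show "fst ((r *\<^sub>R c) $ i + B $ i) - fst ((r *\<^sub>R c) $ j) \<le> r * p_extent A c"
      using mult_left_mono[OF p_extent_ge[of c i A j], of r] le(1)[of i] r
      by (simp add: algebra_simps)
  qed
  moreover have "q_extent B (r *\<^sub>R c) \<le> r * q_extent A c"
  proof (rule q_extent_leI)
    fix i j :: 'n
    show "snd ((r *\<^sub>R c) $ i + B $ i) - snd ((r *\<^sub>R c) $ j) \<le> r * q_extent A c"
      using mult_left_mono[OF q_extent_ge[of c i A j], of r] le(2)[of i] r
      by (simp add: algebra_simps)
  qed
  \<comment> \<open>Multiplying the bounds uses that \<open>r * p_extent A c\<close> and the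
    \<open>q_extent\<close> of \<open>B\<close> are nonnegative.\<close>
  ultimately have "total_area B (r *\<^sub>R c) \<le> (r * p_extent A c) * (r * q_extent A c)"
    unfolding total_area_def using r p_extent_pos[OF A, of c] q_extent_pos[OF B, of "r *\<^sub>R c"]
    by (intro mult_mono) auto
  then show ?thesis
    by (simp add: total_area_def power2_eq_square mult_ac)
qed

text \<open>Each positioning \<open>c\<close> of \<open>A\<close> is compared with its dilate, which
  positions \<open>B\<close>; the bound obtained does not depend on \<open>c\<close>, so it passes
  to the supremum.\<close>

lemma best_efficiency_le_scale:
  assumes r: "0 < r" and A: "A \<in> rect_vectors" and B: "B \<in> rect_vectors"
    and le: "\<And>i. fst (B $ i) \<le> r * fst (A $ i)" "\<And>i. snd (B $ i) \<le> r * snd (A $ i)"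
  shows "best_efficiency A \<le> r\<^sup>2 * (rect_area A / rect_area B) * best_efficiency B"
  unfolding best_efficiency_def[of A]
proof (rule cSUP_least)
  show "{c. positioning A c} \<noteq> {}"
    using positioning_exists[OF A] by blast
next
  fix c assume "c \<in> {c. positioning A c}"
  then have "positioning B (r *\<^sub>R c)"
    using positioning_scaleR[OF r _ le] by blast
  then have "packing_efficiency B (r *\<^sub>R c) \<le> best_efficiency B"
    unfolding best_efficiency_def using bdd_above_packing_efficiency[OF B]
    by (intro cSUP_upper) auto
  \<comment> \<open>The total area of \<open>B\<close> is at most \<open>r\<^sup>2\<close> times
    that of \<open>A\<close>; the quotient of area sums corrects for the different numerators of the
    two efficiencies.\<close>
  moreover have "packing_efficiency A c
      \<le> r\<^sup>2 * (rect_area A / rect_area B) * packing_efficiency B (r *\<^sub>R c)"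
    using total_area_scaleR_le[OF r A B le, of c] total_area_pos[OF A, of c]
      total_area_pos[OF B, of "r *\<^sub>R c"] rect_area_pos[OF A] rect_area_pos[OF B]
    by (simp add: packing_efficiency_def field_simps)
  ultimately show "packing_efficiency A c \<le> r\<^sup>2 * (rect_area A / rect_area B) * best_efficiency B"
    using rect_area_pos[OF A] rect_area_pos[OF B]
    by (elim order_trans) (intro mult_left_mono, auto)
qed

text \<open>A dilation factor dominating all side ratios between \<open>A\<close> and \<open>B\<close> in both directions; a sum
  of deviations instead of a maximum of ratios, so that it is evidently continuous.\<close>

definition side_distortion :: "(real \<times> real) ^ 'n \<Rightarrow> (real \<times> real) ^ 'n \<Rightarrow> real" where
  "side_distortion A B = 1 +
     (\<Sum>i\<in>UNIV. \<bar>fst (B $ i) / fst (A $ i) - 1\<bar> + \<bar>snd (B $ i) / snd (A $ i) - 1\<bar>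
            + \<bar>fst (A $ i) / fst (B $ i) - 1\<bar> + \<bar>snd (A $ i) / snd (B $ i) - 1\<bar>)"

lemma side_distortion_pos: "0 < side_distortion A B"
  unfolding side_distortion_def by (intro add_pos_nonneg sum_nonneg) auto

text \<open>Each ratio occurs together with its reciprocal, so a single factor serves both
  comparisons in the squeeze.\<close>

lemma side_distortion_commute: "side_distortion A B = side_distortion B A"
  by (simp add: side_distortion_def algebra_simps)

lemma side_le_distortion:
  assumes A: "A \<in> rect_vectors"
  shows "fst (B $ i) \<le> side_distortion A B * fst (A $ i)"
    and "snd (B $ i) \<le> side_distortion A B * snd (A $ i)"
proof -
  define g where "g i = \<bar>fst (B $ i) / fst (A $ i) - 1\<bar> + \<bar>snd (B $ i) / snd (A $ i) - 1\<bar>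
            + \<bar>fst (A $ i) / fst (B $ i) - 1\<bar> + \<bar>snd (A $ i) / snd (B $ i) - 1\<bar>" for i
  \<comment> \<open>A ratio exceeds 1 by at most its absolute deviation, which is one of the
    nonnegative terms of the sum.\<close>
  have "g i \<le> (\<Sum>i\<in>UNIV. g i)"
    by (rule member_le_sum) (auto simp: g_def)
  then have "1 + g i \<le> side_distortion A B"
    by (simp add: side_distortion_def g_def)
  then have "fst (B $ i) / fst (A $ i) \<le> side_distortion A B"
      "snd (B $ i) / snd (A $ i) \<le> side_distortion A B"
    unfolding g_def by linarith+
  then show "fst (B $ i) \<le> side_distortion A B * fst (A $ i)"
      "snd (B $ i) \<le> side_distortion A B * snd (A $ i)"
    using A by (auto simp: rect_vectors_def pos_divide_le_eq)
qed

section \<open>Limits of the bounds and the squeeze\<close>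

lemma tendsto_side_distortion:
  assumes A: "A \<in> rect_vectors"
  shows "((\<lambda>B. side_distortion A B) \<longlongrightarrow> 1) (at A within S)"
proof -
  have nz: "fst (A $ i) \<noteq> 0" "snd (A $ i) \<noteq> 0" for i
    using A by (auto simp: rect_vectors_def less_imp_neq[symmetric])
  \<comment> \<open>The sides of \<open>B\<close> in the denominators tend to the nonzero sides of
    \<open>A\<close>, so all quotients converge.\<close>
  have "((\<lambda>B. side_distortion A B) \<longlongrightarrow> side_distortion A A) (at A within S)"
    unfolding side_distortion_def using nz by (intro tendsto_intros) auto
  also have "side_distortion A A = 1"
    using nz by (simp add: side_distortion_def)
  finally show ?thesis .
qed

lemma tendsto_rect_area: "(rect_area \<longlongrightarrow> rect_area A) (at A within S)"
  unfolding rect_area_def by (intro tendsto_intros)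

lemma continuous_on_best_efficiency:
  "continuous_on rect_vectors (best_efficiency :: (real \<times> real) ^ 'n::finite \<Rightarrow> real)"
  unfolding continuous_on_def
proof
  fix A :: "(real \<times> real) ^ 'n" assume A: "A \<in> rect_vectors"
  let ?F = "at A within rect_vectors"
  let ?r = "side_distortion A"
  have in_R: "eventually (\<lambda>B. B \<in> rect_vectors) ?F"
    by (simp add: eventually_at_filter)
  have S: "rect_area A \<noteq> 0"
    using rect_area_pos[OF A] by simp
  show "(best_efficiency \<longlongrightarrow> best_efficiency A) ?F"
  proof (rule tendsto_sandwich)
    show "eventually (\<lambda>B. best_efficiency A * (rect_area B / rect_area A) / (?r B)\<^sup>2
        \<le> best_efficiency B) ?F"
      using in_R
    proof eventually_elim
      case (elim B)
      \<comment> \<open>The comparison from \<open>A\<close> to \<open>B\<close>, solved for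
        \<open>best_efficiency B\<close>.\<close>
      show ?case
        using best_efficiency_le_scale[OF side_distortion_pos A elim side_le_distortion[OF A]]
          rect_area_pos[OF A] rect_area_pos[OF elim] side_distortion_pos[of A B]
        by (simp add: field_simps)
    qed
    show "eventually (\<lambda>B. best_efficiency B
        \<le> (?r B)\<^sup>2 * (rect_area B / rect_area A) * best_efficiency A) ?F"
      using in_R
    proof eventually_elim
      case (elim B)
      \<comment> \<open>The comparison from \<open>B\<close> to \<open>A\<close>, rewritten by the
        symmetry of the distortion.\<close>
      show ?case
        using best_efficiency_le_scale[OF side_distortion_pos elim A side_le_distortion[OF elim]]
        by (simp add: side_distortion_commute[of A B])
    qed
    \<comment> \<open>In both bounds the distortion and the quotient of area sums tend to 1, leaving
      \<open>best_efficiency A\<close>.\<close>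
    have "((\<lambda>B. best_efficiency A * (rect_area B / rect_area A) / (?r B)\<^sup>2)
        \<longlongrightarrow> best_efficiency A * (rect_area A / rect_area A) / 1\<^sup>2) ?F"
      using S by (intro tendsto_intros tendsto_side_distortion tendsto_rect_area A) auto
    then show "((\<lambda>B. best_efficiency A * (rect_area B / rect_area A) / (?r B)\<^sup>2)
        \<longlongrightarrow> best_efficiency A) ?F"
      using S by simp
    have "((\<lambda>B. (?r B)\<^sup>2 * (rect_area B / rect_area A) * best_efficiency A)
        \<longlongrightarrow> 1\<^sup>2 * (rect_area A / rect_area A) * best_efficiency A) ?F"
      using S by (intro tendsto_intros tendsto_side_distortion tendsto_rect_area A) auto
    then show "((\<lambda>B. (?r B)\<^sup>2 * (rect_area B / rect_area A) * best_efficiency A)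
        \<longlongrightarrow> best_efficiency A) ?F"
      using S by simp
  qed
qed

theorem theorem1:
  "(best_efficiency :: (real \<times> real) ^ 'n::finite \<Rightarrow> real) \<in> rect_vectors \<rightarrow> {0..1}
   \<and> continuous_on rect_vectors (best_efficiency :: (real \<times> real) ^ 'n::finite \<Rightarrow> real)"
  using best_efficiency_in_01 continuous_on_best_efficiency by blast

end
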